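(* Let $\Theta$ be a variety of many-sorted algebras such that $\Phi(F(x^{(i)}))\cong F(x^{(i)})$ for every automorphism $\Phi$ of the category $\Theta^0$, every sort $i\in\Gamma$ and every $x^{(i)}\in X_0^{(i)}$. There is a one-to-one and onto correspondence $\Phi\mapsto W^{\Phi}$ between the family of all strongly stable automorphisms of the category $\Theta^0$ and the family of all systems of words which fulfill the conditions Op1) and Op2). The system of words $W^{\Phi}=\{w_\omega\mid\omega\in\Omega\}$ is defined by $$w_\omega=s_{A_\omega}\bigl(\omega(x^{(i_1)},\ldots,x^{(i_n)})\bigr)\in A_\omega\qquad(\omega\in\Omega,\ \tau_\omega=(i_1,\ldots,i_n;j)),$$ where $\{s_F\mid F\in\mathrm{Ob}\,\Theta^0\}$ is the system of bijections from the definition of strong stability (conditions A2)–A4)) of $\Phi$.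
   Context: Many-sorted algebras. Fix a finite set $\Gamma$ of names of sorts and a signature $\Omega$; each $\omega\in\Omega$ has a type $\tau_\omega=(i_1,\ldots,i_n;j)$ with $n\in\mathbb{N}$ ($n=0$ allowed: a constant of sort $j$) and $i_1,\ldots,i_n,j\in\Gamma$. An algebra is a set $A$ with a map $\eta_A:A\to\Gamma$ and, for each $\omega\in\Omega$ of type $(i_1,\ldots,i_n;j)$, an operation $A^{(i_1)}\times\cdots\times A^{(i_n)}\to A^{(j)}$, where $A^{(i)}=\eta_A^{-1}(i)$. The sets $A^{(i)}$ may be empty; $\Gamma_A=\mathrm{im}\,\eta_A$. A homomorphism $\varphi:A\to B$ is a map with $\eta_A=\eta_B\varphi$ commuting with all operations. An identity $w_1=w_2$ is a pair of terms of the same sort over a $\Gamma$-sorted alphabet; if $X'$ is the finite set of letters occurring in $w_1$ or $w_2$, the identity holds in $A$ if $\varphi(w_1)=\varphi(w_2)$ for every homomorphism $\varphi$ from the term algebra over $X'$ to $A$. A variety $\Theta$ is the class of all algebras satisfying a given set of identities. An algebra $F=F(X)\in\Theta$ is free with set of free generators $X\subset F$ if for every $A\in\Theta$ with $\Gamma_A\supseteq\eta_F(X)$ every sort-preserving map $X\to A$ extends to a unique homomorphism $F\to A$. The category $\Theta^0$. Let $X_0$ be a $\Gamma$-sorted set such that the set $X_0^{(i)}$ of its elements of sort $i$ is countably infinite for every $i\in\Gamma$. The objects of $\Theta^0$ are the free algebras $F(X)$ of $\Theta$ with $X\subset X_0$ finite; the morphisms are all homomorphisms between them. $F(x^{(i)})$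 is the free algebra on the single generator $x^{(i)}$. An automorphism $\Phi$ of $\Theta^0$ is strongly stable if: A1) $\Phi$ preserves all objects of $\Theta^0$; A2) there is a system of bijections $\{s_F:F\to F\mid F\in\mathrm{Ob}\,\Theta^0\}$ with $\eta_F=\eta_Fs_F$ for every $F$; A3) $\Phi(\mu)=s_B\mu s_A^{-1}$ for every morphism $\mu:A\to B$ of $\Theta^0$; A4) $s_F|_X=\mathrm{id}_X$ for every $F=F(X)\in\mathrm{Ob}\,\Theta^0$. Words and verbal operations. For $\omega\in\Omega$ of type $(i_1,\ldots,i_n;j)$ fix $A_\omega=F(X_\omega)\in\mathrm{Ob}\,\Theta^0$ with $X_\omega=\{x^{(i_1)},\ldots,x^{(i_n)}\}$ consisting of $n$ distinct generators, $x^{(i_k)}$ being of sort $i_k$. For a word $w\in F(x_1,\ldots,x_n)=F\in\mathrm{Ob}\,\Theta^0$ and $H\in\Theta$, the verbal operation $w_H^*$ is defined for $h_1,\ldots,h_n\in H$ with $\eta_H(h_k)=\eta_F(x_k)$ by $w_H^*(h_1,\ldots,h_n)=\alpha(w)$, where $\alpha:F\to H$ is the homomorphism with $\alpha(x_k)=h_k$; it has type $(\eta_F(x_1),\ldots,\eta_F(x_n);\eta_F(w))$. For a system of words $W=\{w_\omega\in A_\omega\mid\omega\in\Omega\}$, $H_W^*$ denotes the algebra with the same underlying sorted set as $H$ in which each $\omega\in\Omega$ is interpreted by the verbal operation $\omega^*$ defined by $w_\omega$. Conditions on a system of words $W$: Op1) $W=\{w_\omega\in A_\omega\mid\omega\in\Omega\}$;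 Op2) for every $F=F(X)\in\mathrm{Ob}\,\Theta^0$ there is a bijection $s_F:F\to F$ such that $s_F|_X=\mathrm{id}_X$ and $s_F:F\to F_W^*$ is an isomorphism (with $\omega$ corresponding to $\omega^*$; in particular each $w_\omega$ has the sort $j$ of the result of $\omega$). *)

theory Defs
  imports Main "HOL-Library.FuncSet" "HOL-Library.Countable_Set"
begin

text \<open>The type of \<open>\<omega>\<close> is \<open>(i\<^sub>1, \<dots>, i\<^sub>n; j)\<close> with \<open>arity \<Sigma> \<omega> = [i\<^sub>1, \<dots>, i\<^sub>n]\<close> and
  \<open>res \<Sigma> \<omega> = j\<close>.\<close>

record ('o, 's) signature =
  sorts :: "'s set"
  ops :: "'o set"
  arity :: "'o \<Rightarrow> 's list"
  res :: "'o \<Rightarrow> 's"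

definition wf_signature :: "('o, 's) signature \<Rightarrow> bool" where
  "wf_signature \<Sigma> \<longleftrightarrow> finite (sorts \<Sigma>) \<and>
     (\<forall>\<omega>\<in>ops \<Sigma>. set (arity \<Sigma> \<omega>) \<subseteq> sorts \<Sigma> \<and> res \<Sigma> \<omega> \<in> sorts \<Sigma>)"

record ('a, 's) sorted_set =
  carrier :: "'a set"
  srt :: "'a \<Rightarrow> 's"

record ('a, 's, 'o) algebra = "('a, 's) sorted_set" +
  oper :: "'o \<Rightarrow> 'a list \<Rightarrow> 'a"

definition is_sorted_set :: "('o, 's) signature \<Rightarrow> ('a, 's, 'z) sorted_set_scheme \<Rightarrow> bool" where
  "is_sorted_set \<Sigma> A \<longleftrightarrow> srt A \<in> carrier A \<rightarrow> sorts \<Sigma>"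

definition of_sort :: "('a, 's, 'z) sorted_set_scheme \<Rightarrow> 's \<Rightarrow> 'a set" where
  "of_sort A i = {a \<in> carrier A. srt A a = i}"

definition tuples :: "('a, 's, 'z) sorted_set_scheme \<Rightarrow> 's list \<Rightarrow> 'a list set" where
  "tuples A is = {as. set as \<subseteq> carrier A \<and> map (srt A) as = is}"

text \<open>Components \<open>of_sort A i\<close> may be empty; the values of \<open>oper\<close> outside \<open>ops \<Sigma>\<close> and outside the
  tuples of the right sorts are irrelevant.\<close>

definition is_algebra :: "('o, 's) signature \<Rightarrow> ('a, 's, 'o) algebra \<Rightarrow> bool" where
  "is_algebra \<Sigma> A \<longleftrightarrow> is_sorted_set \<Sigma> A \<and>
     (\<forall>\<omega>\<in>ops \<Sigma>. \<forall>as\<in>tuples A (arity \<Sigma> \<omega>). oper A \<omega> as \<in> of_sort A (res \<Sigma> \<omega>))"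

definition alg_hom ::
  "('o, 's) signature \<Rightarrow> ('a, 's, 'o) algebra \<Rightarrow> ('b, 's, 'o) algebra \<Rightarrow> ('a \<Rightarrow> 'b) set" where
  "alg_hom \<Sigma> A B = {\<phi> \<in> carrier A \<rightarrow>\<^sub>E carrier B.
     (\<forall>a\<in>carrier A. srt B (\<phi> a) = srt A a) \<and>
     (\<forall>\<omega>\<in>ops \<Sigma>. \<forall>as\<in>tuples A (arity \<Sigma> \<omega>). \<phi> (oper A \<omega> as) = oper B \<omega> (map \<phi> as))}"

definition alg_iso ::
  "('o, 's) signature \<Rightarrow> ('a, 's, 'o) algebra \<Rightarrow> ('b, 's, 'o) algebra \<Rightarrow> ('a \<Rightarrow> 'b) set" where
  "alg_iso \<Sigma> A B = {\<phi> \<in> alg_hom \<Sigma> A B. bij_betw \<phi> (carrier A) (carrier B)}"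

datatype (letters: 'v, symbols: 'o) trm = Var 'v | App 'o "('v, 'o) trm list"

fun trm_sort :: "('o, 's) signature \<Rightarrow> ('v \<Rightarrow> 's) \<Rightarrow> ('v, 'o) trm \<Rightarrow> 's" where
  "trm_sort \<Sigma> \<eta> (Var v) = \<eta> v"
| "trm_sort \<Sigma> \<eta> (App \<omega> ts) = res \<Sigma> \<omega>"

inductive_set wf_terms :: "('o, 's) signature \<Rightarrow> 'v set \<Rightarrow> ('v \<Rightarrow> 's) \<Rightarrow> ('v, 'o) trm set"
  for \<Sigma> X \<eta> where
  "v \<in> X \<Longrightarrow> Var v \<in> wf_terms \<Sigma> X \<eta>"
| "\<omega> \<in> ops \<Sigma> \<Longrightarrow> \<forall>t\<in>set ts. t \<in> wf_terms \<Sigma> X \<eta> \<Longrightarrow> map (trm_sort \<Sigma> \<eta>) ts = arity \<Sigma> \<omega> \<Longrightarrow>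
     App \<omega> ts \<in> wf_terms \<Sigma> X \<eta>"

definition term_algebra ::
  "('o, 's) signature \<Rightarrow> 'v set \<Rightarrow> ('v \<Rightarrow> 's) \<Rightarrow> (('v, 'o) trm, 's, 'o) algebra" where
  "term_algebra \<Sigma> X \<eta> = \<lparr>carrier = wf_terms \<Sigma> X \<eta>, srt = trm_sort \<Sigma> \<eta>, oper = App\<rparr>"

definition identities ::
  "('o, 's) signature \<Rightarrow> ('v, 's) sorted_set \<Rightarrow> (('v, 'o) trm \<times> ('v, 'o) trm) set" where
  "identities \<Sigma> V = {(w1, w2). w1 \<in> wf_terms \<Sigma> (carrier V) (srt V) \<and>
     w2 \<in> wf_terms \<Sigma> (carrier V) (srt V) \<and> trm_sort \<Sigma> (srt V) w1 = trm_sort \<Sigma> (srt V) w2}"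

text \<open>Only the letters that occur are evaluated, so an identity holds vacuously in an algebra with
  no elements of the sort of one of its letters.\<close>

definition satisfies :: "('o, 's) signature \<Rightarrow> ('v, 's) sorted_set \<Rightarrow> ('a, 's, 'o) algebra \<Rightarrow>
    ('v, 'o) trm \<times> ('v, 'o) trm \<Rightarrow> bool" where
  "satisfies \<Sigma> V A = (\<lambda>(w1, w2).
     \<forall>\<phi>\<in>alg_hom \<Sigma> (term_algebra \<Sigma> (letters w1 \<union> letters w2) (srt V)) A. \<phi> w1 = \<phi> w2)"

text \<open>A type-indexed class: for each type \<open>'a\<close>, the algebras of the variety whose elements are drawn
  from \<open>'a\<close>.\<close>

definition variety :: "('o, 's) signature \<Rightarrow> ('v, 's) sorted_set \<Rightarrow>
    (('v, 'o) trm \<times> ('v, 'o) trm) set \<Rightarrow> ('a, 's, 'o) algebra set" where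
  "variety \<Sigma> V E = {A. is_algebra \<Sigma> A \<and> (\<forall>e\<in>E. satisfies \<Sigma> V A e)}"

text \<open>HOL cannot quantify over all types inside a formula, so the universal property ranges over the
  algebras of the class whose elements are drawn from the same type as those of \<open>F\<close>. An algebra that
  is free with respect to algebras over all types is in particular free in this sense.\<close>

definition is_free :: "('o, 's) signature \<Rightarrow> ('a, 's, 'o) algebra set \<Rightarrow>
    ('a, 's, 'o) algebra \<Rightarrow> 'a set \<Rightarrow> bool" where
  "is_free \<Sigma> \<Theta> F X \<longleftrightarrow> F \<in> \<Theta> \<and> X \<subseteq> carrier F \<and>
     (\<forall>A\<in>\<Theta>. srt F ` X \<subseteq> srt A ` carrier A \<longrightarrow>
        (\<forall>f. (\<forall>x\<in>X. f x \<in> of_sort A (srt F x)) \<longrightarrow>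
           (\<exists>!\<phi>. \<phi> \<in> alg_hom \<Sigma> F A \<and> (\<forall>x\<in>X. \<phi> x = f x))))"

record ('b, 'm) category =
  Obj :: "'b set"
  Arr :: "'m set"
  Dom :: "'m \<Rightarrow> 'b"
  Cod :: "'m \<Rightarrow> 'b"
  Ident :: "'b \<Rightarrow> 'm"
  Comp :: "'m \<Rightarrow> 'm \<Rightarrow> 'm"

record ('b, 'm) endofunctor =
  on_obj :: "'b \<Rightarrow> 'b"
  on_arr :: "'m \<Rightarrow> 'm"

text \<open>Both maps are extensional, so that equality of records is equality of functors.\<close>

definition is_endofunctor :: "('b, 'm) category \<Rightarrow> ('b, 'm) endofunctor \<Rightarrow> bool" where
  "is_endofunctor C \<Phi> \<longleftrightarrow>
     on_obj \<Phi> \<in> Obj C \<rightarrow>\<^sub>E Obj C \<and> on_arr \<Phi> \<in> Arr C \<rightarrow>\<^sub>E Arr C \<and>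
     (\<forall>f\<in>Arr C. Dom C (on_arr \<Phi> f) = on_obj \<Phi> (Dom C f) \<and>
                Cod C (on_arr \<Phi> f) = on_obj \<Phi> (Cod C f)) \<and>
     (\<forall>a\<in>Obj C. on_arr \<Phi> (Ident C a) = Ident C (on_obj \<Phi> a)) \<and>
     (\<forall>f\<in>Arr C. \<forall>g\<in>Arr C. Cod C f = Dom C g \<longrightarrow>
        on_arr \<Phi> (Comp C g f) = Comp C (on_arr \<Phi> g) (on_arr \<Phi> f))"

definition is_automorphism :: "('b, 'm) category \<Rightarrow> ('b, 'm) endofunctor \<Rightarrow> bool" where
  "is_automorphism C \<Phi> \<longleftrightarrow> is_endofunctor C \<Phi> \<and>
     bij_betw (on_obj \<Phi>) (Obj C) (Obj C) \<and> bij_betw (on_arr \<Phi>) (Arr C) (Arr C)"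

text \<open>\<open>F X\<close> is the free algebra chosen for the finite set \<open>X \<subseteq> X\<^sub>0\<close> of free generators. An object
  comes with its distinguished set of generators and is represented by it; a morphism
  \<open>\<mu> : F X \<rightarrow> F Y\<close> is the triple \<open>(X, \<mu>, Y)\<close>.\<close>

definition theta0_obj :: "('a, 's) sorted_set \<Rightarrow> 'a set set" where
  "theta0_obj X0 = {X. finite X \<and> X \<subseteq> carrier X0}"

definition theta0 :: "('o, 's) signature \<Rightarrow> ('a, 's) sorted_set \<Rightarrow>
    ('a set \<Rightarrow> ('a, 's, 'o) algebra) \<Rightarrow> ('a set, 'a set \<times> ('a \<Rightarrow> 'a) \<times> 'a set) category" where
  "theta0 \<Sigma> X0 F = \<lparr>
     Obj = theta0_obj X0,
     Arr = {(X, \<mu>, Y). X \<in> theta0_obj X0 \<and> Y \<in> theta0_obj X0 \<and> \<mu> \<in> alg_hom \<Sigma> (F X) (F Y)},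
     Dom = (\<lambda>(X, \<mu>, Y). X),
     Cod = (\<lambda>(X, \<mu>, Y). Y),
     Ident = (\<lambda>X. (X, \<lambda>a\<in>carrier (F X). a, X)),
     Comp = (\<lambda>(Y, \<nu>, Z) (X, \<mu>, Y'). (X, compose (carrier (F X)) \<nu> \<mu>, Z))\<rparr>"

definition stable_system :: "('o, 's) signature \<Rightarrow> ('a, 's) sorted_set \<Rightarrow>
    ('a set \<Rightarrow> ('a, 's, 'o) algebra) \<Rightarrow>
    ('a set, 'a set \<times> ('a \<Rightarrow> 'a) \<times> 'a set) endofunctor \<Rightarrow> ('a set \<Rightarrow> 'a \<Rightarrow> 'a) \<Rightarrow> bool" where
  "stable_system \<Sigma> X0 F \<Phi> s \<longleftrightarrow>
     (\<forall>X\<in>theta0_obj X0. bij_betw (s X) (carrier (F X)) (carrier (F X)) \<and>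
        (\<forall>a\<in>carrier (F X). srt (F X) (s X a) = srt (F X) a)) \<and>
     (\<forall>X\<in>theta0_obj X0. \<forall>Y\<in>theta0_obj X0. \<forall>\<mu>\<in>alg_hom \<Sigma> (F X) (F Y).
        on_arr \<Phi> (X, \<mu>, Y) =
          (X, \<lambda>a\<in>carrier (F X). s Y (\<mu> (inv_into (carrier (F X)) (s X) a)), Y)) \<and>
     (\<forall>X\<in>theta0_obj X0. \<forall>x\<in>X. s X x = x)"

definition strongly_stable :: "('o, 's) signature \<Rightarrow> ('a, 's) sorted_set \<Rightarrow>
    ('a set \<Rightarrow> ('a, 's, 'o) algebra) \<Rightarrow>
    ('a set, 'a set \<times> ('a \<Rightarrow> 'a) \<times> 'a set) endofunctor \<Rightarrow> bool" where
  "strongly_stable \<Sigma> X0 F \<Phi> \<longleftrightarrow> is_automorphism (theta0 \<Sigma> X0 F) \<Phi> \<and>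
     (\<forall>X\<in>theta0_obj X0. on_obj \<Phi> X = X) \<and> (\<exists>s. stable_system \<Sigma> X0 F \<Phi> s)"

text \<open>The operation on \<open>H\<close> defined by the word \<open>w\<close> of the algebra \<open>F\<close> with the list \<open>xs\<close> of free
  generators.\<close>

definition verbal_op :: "('o, 's) signature \<Rightarrow> ('a, 's, 'o) algebra \<Rightarrow> 'a list \<Rightarrow> 'a \<Rightarrow>
    ('b, 's, 'o) algebra \<Rightarrow> 'b list \<Rightarrow> 'b" where
  "verbal_op \<Sigma> F xs w H hs = (THE \<alpha>. \<alpha> \<in> alg_hom \<Sigma> F H \<and> map \<alpha> xs = hs) w"

text \<open>Here and below \<open>x \<omega>\<close> is the list of generators of \<open>A\<^sub>\<omega> = F (set (x \<omega>))\<close>.\<close>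

definition verbal_algebra :: "('o, 's) signature \<Rightarrow> ('a set \<Rightarrow> ('a, 's, 'o) algebra) \<Rightarrow>
    ('o \<Rightarrow> 'a list) \<Rightarrow> ('o \<Rightarrow> 'a) \<Rightarrow> ('b, 's, 'o) algebra \<Rightarrow> ('b, 's, 'o) algebra" where
  "verbal_algebra \<Sigma> F x W H =
     H\<lparr>oper := (\<lambda>\<omega>. verbal_op \<Sigma> (F (set (x \<omega>))) (x \<omega>) (W \<omega>) H)\<rparr>"

definition Op1 :: "('o, 's) signature \<Rightarrow> ('a set \<Rightarrow> ('a, 's, 'o) algebra) \<Rightarrow>
    ('o \<Rightarrow> 'a list) \<Rightarrow> ('o \<Rightarrow> 'a) \<Rightarrow> bool" where
  "Op1 \<Sigma> F x W \<longleftrightarrow> W \<in> (\<Pi>\<^sub>E \<omega>\<in>ops \<Sigma>. carrier (F (set (x \<omega>))))"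

definition Op2 :: "('o, 's) signature \<Rightarrow> ('a, 's) sorted_set \<Rightarrow>
    ('a set \<Rightarrow> ('a, 's, 'o) algebra) \<Rightarrow> ('o \<Rightarrow> 'a list) \<Rightarrow> ('o \<Rightarrow> 'a) \<Rightarrow> bool" where
  "Op2 \<Sigma> X0 F x W \<longleftrightarrow>
     (\<forall>X\<in>theta0_obj X0. \<exists>s\<in>alg_iso \<Sigma> (F X) (verbal_algebra \<Sigma> F x W (F X)). \<forall>y\<in>X. s y = y)"

definition words_of :: "('o, 's) signature \<Rightarrow> ('a set \<Rightarrow> ('a, 's, 'o) algebra) \<Rightarrow>
    ('o \<Rightarrow> 'a list) \<Rightarrow> ('a set \<Rightarrow> 'a \<Rightarrow> 'a) \<Rightarrow> 'o \<Rightarrow> 'a" where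
  "words_of \<Sigma> F x s = (\<lambda>\<omega>\<in>ops \<Sigma>. s (set (x \<omega>)) (oper (F (set (x \<omega>))) \<omega> (x \<omega>)))"

end

theory Submission
  imports Defs
begin

text \<open>Let \<open>s\<close> be a system of bijections fixing the generators. Evaluating \<open>\<Phi> \<mu> = s \<mu> s\<^sup>-\<^sup>1\<close> at a generator
  shows that \<open>s\<close> is determined by \<open>\<Phi>\<close>, and evaluating it at the words \<open>w\<^sub>\<omega>\<close> shows that each \<open>s\<^sub>F\<close> is an
  isomorphism \<open>F \<rightarrow> F\<^sub>W\<^sup>*\<close>. Conversely \<open>W\<close> determines \<open>s\<close>, because two isomorphisms \<open>F \<rightarrow> F\<^sub>W\<^sup>*\<close> fixing the
  generators differ by an endomorphism of \<open>F\<close> fixing them. Given \<open>W\<close> with its isomorphisms \<open>s\<^sub>F\<close>, the map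
  \<open>\<nu> \<mapsto> s\<^sub>B\<^sup>-\<^sup>1 \<nu> s\<^sub>A\<close> sends homomorphisms to homomorphisms, since these also respect verbal operations. It
  is onto: the preimage of \<open>\<mu>\<close> is the homomorphism \<open>\<nu>\<close> that agrees with \<open>s\<^sub>B \<mu>\<close> on the generators. Its
  inverse is the strongly stable automorphism with system of words \<open>W\<close>.\<close>

section \<open>Homomorphisms of many-sorted algebras\<close>

lemma alg_homD:
  assumes "\<phi> \<in> alg_hom \<Sigma> A B"
  shows alg_hom_extensional: "\<phi> \<in> carrier A \<rightarrow>\<^sub>E carrier B"
    and alg_hom_carrier: "a \<in> carrier A \<Longrightarrow> \<phi> a \<in> carrier B"
    and alg_hom_srt: "a \<in> carrier A \<Longrightarrow> srt B (\<phi> a) = srt A a"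
    and alg_hom_oper: "\<omega> \<in> ops \<Sigma> \<Longrightarrow> as \<in> tuples A (arity \<Sigma> \<omega>) \<Longrightarrow>
      \<phi> (oper A \<omega> as) = oper B \<omega> (map \<phi> as)"
  using assms unfolding alg_hom_def by auto

lemma tuples_map:
  assumes "as \<in> tuples A is"
    and "\<And>a. a \<in> carrier A \<Longrightarrow> f a \<in> carrier B \<and> srt B (f a) = srt A a"
  shows "map f as \<in> tuples B is"
  using assms unfolding tuples_def by (auto simp: subset_iff)

lemma alg_hom_tuples:
  "\<phi> \<in> alg_hom \<Sigma> A B \<Longrightarrow> as \<in> tuples A is \<Longrightarrow> map \<phi> as \<in> tuples B is"
  by (rule tuples_map) (auto simp: alg_homD)

lemma oper_carrier:
  "is_algebra \<Sigma> A \<Longrightarrow> \<omega> \<in> ops \<Sigma> \<Longrightarrow> as \<in> tuples A (arity \<Sigma> \<omega>) \<Longrightarrow> oper A \<omega> as \<in> carrier A"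
  unfolding is_algebra_def of_sort_def by auto

text \<open>\<open>is_algebra \<Sigma> A\<close> keeps \<open>oper A \<omega> as\<close> inside the
  carrier, where \<open>compose\<close> has its intended value and not \<open>undefined\<close>. The
  middle structure \<open>B\<close> is arbitrary, so a verbal algebra may stand there.\<close>

lemma alg_hom_compose:
  assumes "is_algebra \<Sigma> A" "\<phi> \<in> alg_hom \<Sigma> A B" "\<psi> \<in> alg_hom \<Sigma> B C"
  shows "compose (carrier A) \<psi> \<phi> \<in> alg_hom \<Sigma> A C"
proof -
  have "compose (carrier A) \<psi> \<phi> (oper A \<omega> as) = oper C \<omega> (map (compose (carrier A) \<psi> \<phi>) as)"
    if "\<omega> \<in> ops \<Sigma>" "as \<in> tuples A (arity \<Sigma> \<omega>)" for \<omega> as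
  proof -
    have "map (compose (carrier A) \<psi> \<phi>) as = map \<psi> (map \<phi> as)"
      using that(2) by (auto simp: tuples_def compose_def)
    then show ?thesis
      using that assms
      by (simp add: compose_eq oper_carrier alg_hom_oper alg_hom_tuples del: map_map map_eq_conv)
  qed
  then show ?thesis
    using assms unfolding alg_hom_def[of \<Sigma> A C]
    by (auto simp: compose_eq alg_hom_srt alg_hom_carrier)
      (auto simp: compose_def alg_hom_carrier)
qed

lemma alg_hom_ident:
  assumes "is_algebra \<Sigma> A"
  shows "(\<lambda>a\<in>carrier A. a) \<in> alg_hom \<Sigma> A A"
proof -
  have "map (\<lambda>a\<in>carrier A. a) as = as" if "as \<in> tuples A is" for as "is"
    using that by (auto simp: tuples_def intro!: map_idI)
  then show ?thesis
    using assms unfolding alg_hom_def by (auto simp: oper_carrier)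
qed

text \<open>Every tuple of \<open>B\<close> is the image under \<open>\<phi>\<close> of a tuple of
  \<open>A\<close>, and the homomorphism law for the latter, read backwards, is the law for the
  inverse. Below, \<open>B\<close> is a verbal algebra.\<close>

lemma alg_iso_inverse:
  assumes A: "is_algebra \<Sigma> A" and iso: "\<phi> \<in> alg_iso \<Sigma> A B"
  shows "(\<lambda>b\<in>carrier B. inv_into (carrier A) \<phi> b) \<in> alg_hom \<Sigma> B A"
proof -
  let ?g = "\<lambda>b\<in>carrier B. inv_into (carrier A) \<phi> b"
  have hom: "\<phi> \<in> alg_hom \<Sigma> A B" and bij: "bij_betw \<phi> (carrier A) (carrier B)"
    using iso unfolding alg_iso_def by auto
  have gcar: "?g b \<in> carrier A" and \<phi>g: "\<phi> (?g b) = b" if "b \<in> carrier B" for b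
    using that bij by (auto simp: bij_betw_def inv_into_into f_inv_into_f)
  have g\<phi>: "?g (\<phi> a) = a" if "a \<in> carrier A" for a
    using that bij alg_hom_carrier[OF hom that] by (simp add: bij_betw_def inv_into_f_f)
  have gsrt: "srt A (?g b) = srt B b" if "b \<in> carrier B" for b
    using alg_hom_srt[OF hom gcar[OF that]] \<phi>g[OF that] by simp
  have "?g (oper B \<omega> bs) = oper A \<omega> (map ?g bs)"
    if \<omega>: "\<omega> \<in> ops \<Sigma>" and bs: "bs \<in> tuples B (arity \<Sigma> \<omega>)" for \<omega> bs
  proof -
    have as: "map ?g bs \<in> tuples A (arity \<Sigma> \<omega>)"
      using bs gcar gsrt by (intro tuples_map) auto
    have "map \<phi> (map ?g bs) = bs"
      using bs \<phi>g by (auto simp: tuples_def intro!: map_idI)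
    then have "oper B \<omega> bs = \<phi> (oper A \<omega> (map ?g bs))"
      using alg_hom_oper[OF hom \<omega> as] by simp
    then show ?thesis
      using g\<phi>[OF oper_carrier[OF A \<omega> as]] by simp
  qed
  then show ?thesis
    using gcar gsrt unfolding alg_hom_def by auto
qed

section \<open>Conjugation, verbal algebras and the category in unfolded form\<close>

text \<open>The map \<open>t \<mu> s\<^sup>-\<^sup>1\<close> of condition A3), with \<open>s\<close>
  acting on the source and \<open>t\<close> on the target of \<open>\<mu>\<close>. It is restricted
  to the carrier of the source so that it is literally the value that \<open>stable_system\<close>
  prescribes.\<close>

definition conjugate :: "('a, 's, 'z) sorted_set_scheme \<Rightarrow> ('a \<Rightarrow> 'a) \<Rightarrow> ('a \<Rightarrow> 'a) \<Rightarrow> ('a \<Rightarrow> 'a) \<Rightarrow> 'a \<Rightarrow> 'a" where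
  "conjugate A s t \<mu> = (\<lambda>a\<in>carrier A. t (\<mu> (inv_into (carrier A) s a)))"

lemma stable_system_on_arr:
  assumes "stable_system \<Sigma> X0 F \<Phi> s" "X \<in> theta0_obj X0" "Y \<in> theta0_obj X0"
    "\<mu> \<in> alg_hom \<Sigma> (F X) (F Y)"
  shows "on_arr \<Phi> (X, \<mu>, Y) = (X, conjugate (F X) (s X) (s Y) \<mu>, Y)"
  using assms unfolding stable_system_def conjugate_def by blast

lemma stable_systemD:
  assumes "stable_system \<Sigma> X0 F \<Phi> s" "X \<in> theta0_obj X0"
  shows "bij_betw (s X) (carrier (F X)) (carrier (F X))"
    and "a \<in> carrier (F X) \<Longrightarrow> srt (F X) (s X a) = srt (F X) a"
    and "y \<in> X \<Longrightarrow> s X y = y"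
  using assms unfolding stable_system_def by blast+

lemma carrier_verbal_algebra [simp]: "carrier (verbal_algebra \<Sigma> F x w H) = carrier H"
  and srt_verbal_algebra [simp]: "srt (verbal_algebra \<Sigma> F x w H) = srt H"
  and oper_verbal_algebra [simp]: "oper (verbal_algebra \<Sigma> F x w H) \<omega> =
    verbal_op \<Sigma> (F (set (x \<omega>))) (x \<omega>) (w \<omega>) H"
  unfolding verbal_algebra_def by simp_all

lemma tuples_verbal_algebra [simp]: "tuples (verbal_algebra \<Sigma> F x w H) is = tuples H is"
  unfolding tuples_def by simp

lemma theta0_simps [simp]:
  "Obj (theta0 \<Sigma> X0 F) = theta0_obj X0"
  "(X, \<mu>, Y) \<in> Arr (theta0 \<Sigma> X0 F) \<longleftrightarrow>
     X \<in> theta0_obj X0 \<and> Y \<in> theta0_obj X0 \<and> \<mu> \<in> alg_hom \<Sigma> (F X) (F Y)"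
  "Dom (theta0 \<Sigma> X0 F) (X, \<mu>, Y) = X"
  "Cod (theta0 \<Sigma> X0 F) (X, \<mu>, Y) = Y"
  "Ident (theta0 \<Sigma> X0 F) X = (X, \<lambda>a\<in>carrier (F X). a, X)"
  "Comp (theta0 \<Sigma> X0 F) (Y, \<nu>, Z) (X, \<mu>, Y') = (X, compose (carrier (F X)) \<nu> \<mu>, Z)"
  unfolding theta0_def by simp_all

section \<open>Free objects and homomorphisms out of them\<close>

text \<open>Collects the consequences of the hypotheses on which the argument runs. A letter of each
  sort provides the one-generator objects by which single elements are probed.\<close>

locale free_objects =
  fixes \<Sigma> :: "('o, 's) signature"
    and \<Theta> :: "('a, 's, 'o) algebra set"
    and X0 :: "('a, 's) sorted_set"
    and F :: "'a set \<Rightarrow> ('a, 's, 'o) algebra"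
    and x :: "'o \<Rightarrow> 'a list"
  assumes algebras: "A \<in> \<Theta> \<Longrightarrow> is_algebra \<Sigma> A"
    and letters_of_sort: "i \<in> sorts \<Sigma> \<Longrightarrow> of_sort X0 i \<noteq> {}"
    and free: "X \<in> theta0_obj X0 \<Longrightarrow> is_free \<Sigma> \<Theta> (F X) X"
    and srt_generator: "X \<in> theta0_obj X0 \<Longrightarrow> y \<in> X \<Longrightarrow> srt (F X) y = srt X0 y"
    and distinct_x: "\<omega> \<in> ops \<Sigma> \<Longrightarrow> distinct (x \<omega>)"
    and tuples_x: "\<omega> \<in> ops \<Sigma> \<Longrightarrow> x \<omega> \<in> tuples X0 (arity \<Sigma> \<omega>)"
begin

abbreviation "A\<^sub>\<omega> \<omega> \<equiv> F (set (x \<omega>))"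
abbreviation "verbal \<equiv> verbal_algebra \<Sigma> F x"

lemma obj_in_variety: "X \<in> theta0_obj X0 \<Longrightarrow> F X \<in> \<Theta>"
  and generators_carrier: "X \<in> theta0_obj X0 \<Longrightarrow> y \<in> X \<Longrightarrow> y \<in> carrier (F X)"
  using free unfolding is_free_def by blast+

lemma obj_algebra: "X \<in> theta0_obj X0 \<Longrightarrow> is_algebra \<Sigma> (F X)"
  using obj_in_variety algebras by blast

text \<open>The condition on sorts in \<open>is_free\<close> is automatic here: the prescribed
  images already witness that every sort occurring in \<open>X\<close> is inhabited in
  \<open>A\<close>.\<close>

lemma hom_extend_unique:
  assumes "X \<in> theta0_obj X0" "A \<in> \<Theta>" "\<And>y. y \<in> X \<Longrightarrow> f y \<in> of_sort A (srt (F X) y)"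
  shows "\<exists>!\<phi>. \<phi> \<in> alg_hom \<Sigma> (F X) A \<and> (\<forall>y\<in>X. \<phi> y = f y)"
proof -
  have "srt (F X) ` X \<subseteq> srt A ` carrier A"
    using assms(3) unfolding of_sort_def by force
  then show ?thesis
    using free[OF assms(1)] assms unfolding is_free_def by blast
qed

lemma hom_extend:
  assumes "X \<in> theta0_obj X0" "A \<in> \<Theta>" "\<And>y. y \<in> X \<Longrightarrow> f y \<in> of_sort A (srt (F X) y)"
  obtains \<phi> where "\<phi> \<in> alg_hom \<Sigma> (F X) A" "\<And>y. y \<in> X \<Longrightarrow> \<phi> y = f y"
  using hom_extend_unique[OF assms] by blast

text \<open>Both maps extend the values of \<open>\<psi>\<close> on \<open>X\<close>, so freeness
  identifies them. Homomorphisms are extensional, hence this is an equality of functions.\<close>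

lemma hom_eqI:
  assumes X: "X \<in> theta0_obj X0" and A: "A \<in> \<Theta>"
    and \<phi>: "\<phi> \<in> alg_hom \<Sigma> (F X) A" and \<psi>: "\<psi> \<in> alg_hom \<Sigma> (F X) A"
    and eq: "\<And>y. y \<in> X \<Longrightarrow> \<phi> y = \<psi> y"
  shows "\<phi> = \<psi>"
proof -
  have "\<psi> y \<in> of_sort A (srt (F X) y)" if "y \<in> X" for y
    using alg_hom_carrier[OF \<psi>] alg_hom_srt[OF \<psi>] generators_carrier[OF X that]
    unfolding of_sort_def by auto
  from hom_extend_unique[OF X A this] show ?thesis
    using \<phi> \<psi> eq by blast
qed

lemma set_x_obj: "\<omega> \<in> ops \<Sigma> \<Longrightarrow> set (x \<omega>) \<in> theta0_obj X0"
  using tuples_x unfolding theta0_obj_def tuples_def by auto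

lemma tuples_x_obj:
  assumes "\<omega> \<in> ops \<Sigma>"
  shows "x \<omega> \<in> tuples (A\<^sub>\<omega> \<omega>) (arity \<Sigma> \<omega>)"
proof -
  have "map (srt (A\<^sub>\<omega> \<omega>)) (x \<omega>) = map (srt X0) (x \<omega>)"
    using srt_generator[OF set_x_obj[OF assms]] by simp
  then show ?thesis
    using tuples_x[OF assms] generators_carrier[OF set_x_obj[OF assms]] unfolding tuples_def
    by (simp add: subset_iff del: map_eq_conv)
qed

text \<open>Arguments for \<open>\<omega>\<close> in \<open>H\<close> are the same thing as a
  homomorphism \<open>A\<^sub>\<omega> \<omega> \<rightarrow> H\<close>: one assigns the entries to
  the free generators.\<close>

lemma tuple_hom:
  assumes \<omega>: "\<omega> \<in> ops \<Sigma>" and H: "H \<in> \<Theta>" and hs: "hs \<in> tuples H (arity \<Sigma> \<omega>)"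
  obtains \<alpha> where "\<alpha> \<in> alg_hom \<Sigma> (A\<^sub>\<omega> \<omega>) H" "map \<alpha> (x \<omega>) = hs"
proof -
  have x: "map (srt (A\<^sub>\<omega> \<omega>)) (x \<omega>) = arity \<Sigma> \<omega>"
    using tuples_x_obj[OF \<omega>] unfolding tuples_def by auto
  have hs': "map (srt H) hs = arity \<Sigma> \<omega>" "set hs \<subseteq> carrier H"
    using hs unfolding tuples_def by auto
  have len: "length hs = length (x \<omega>)"
    using x hs' by (metis length_map)
  \<comment> \<open>Reading the two lists as a lookup table gives the assignment; it hits every
    position because the generators are distinct.\<close>
  define f where "f y = the (map_of (zip (x \<omega>) hs) y)" for y
  have f: "f (x \<omega> ! k) = hs ! k" if "k < length (x \<omega>)" for k
    using that len distinct_x[OF \<omega>] by (simp add: f_def map_of_zip_nth)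
  have "f y \<in> of_sort H (srt (A\<^sub>\<omega> \<omega>) y)" if "y \<in> set (x \<omega>)" for y
  proof -
    from that obtain k where k: "k < length (x \<omega>)" "y = x \<omega> ! k"
      by (auto simp: in_set_conv_nth)
    have "srt H (hs ! k) = srt (A\<^sub>\<omega> \<omega>) (x \<omega> ! k)"
      using x hs' k(1) len by (metis nth_map)
    then show ?thesis
      using k f hs' len unfolding of_sort_def by auto
  qed
  from hom_extend[OF set_x_obj[OF \<omega>] H this] obtain \<alpha>
    where "\<alpha> \<in> alg_hom \<Sigma> (A\<^sub>\<omega> \<omega>) H" "\<And>y. y \<in> set (x \<omega>) \<Longrightarrow> \<alpha> y = f y" by blast
  moreover from this have "map \<alpha> (x \<omega>) = hs"
    using f len by (auto intro!: nth_equalityI)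
  ultimately show ?thesis using that by blast
qed

section \<open>Verbal operations\<close>

text \<open>A homomorphism out of \<open>A\<^sub>\<omega> \<omega>\<close> is determined by its
  values on \<open>x \<omega>\<close>, so the definite description in \<open>verbal_op\<close>
  denotes \<open>\<alpha>\<close>. Verbal operations are always computed through this rule.\<close>

lemma verbal_op_eq:
  assumes "\<omega> \<in> ops \<Sigma>" "H \<in> \<Theta>" "\<alpha> \<in> alg_hom \<Sigma> (A\<^sub>\<omega> \<omega>) H"
  shows "verbal_op \<Sigma> (A\<^sub>\<omega> \<omega>) (x \<omega>) w H (map \<alpha> (x \<omega>)) = \<alpha> w"
proof -
  have "(THE \<beta>. \<beta> \<in> alg_hom \<Sigma> (A\<^sub>\<omega> \<omega>) H \<and> map \<beta> (x \<omega>) = map \<alpha> (x \<omega>)) = \<alpha>"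
    using assms by (intro the_equality) (auto intro!: hom_eqI[OF set_x_obj])
  then show ?thesis unfolding verbal_op_def by simp
qed

text \<open>If \<open>\<alpha>\<close> evaluates words at \<open>hs\<close>, then
  \<open>\<mu>\<close> after \<open>\<alpha>\<close> evaluates them at \<open>map \<mu> hs\<close>.
  The word has to lie in the carrier for \<open>compose\<close> to be evaluated properly.\<close>

lemma hom_verbal:
  assumes H: "H \<in> \<Theta>" and K: "K \<in> \<Theta>" and \<mu>: "\<mu> \<in> alg_hom \<Sigma> H K"
    and w: "\<And>\<omega>. \<omega> \<in> ops \<Sigma> \<Longrightarrow> w \<omega> \<in> carrier (A\<^sub>\<omega> \<omega>)"
  shows "\<mu> \<in> alg_hom \<Sigma> (verbal w H) (verbal w K)"
proof -
  have "\<mu> (verbal_op \<Sigma> (A\<^sub>\<omega> \<omega>) (x \<omega>) (w \<omega>) H hs) =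
      verbal_op \<Sigma> (A\<^sub>\<omega> \<omega>) (x \<omega>) (w \<omega>) K (map \<mu> hs)"
    if \<omega>: "\<omega> \<in> ops \<Sigma>" and hs: "hs \<in> tuples H (arity \<Sigma> \<omega>)" for \<omega> hs
  proof -
    obtain \<alpha> where \<alpha>: "\<alpha> \<in> alg_hom \<Sigma> (A\<^sub>\<omega> \<omega>) H" "map \<alpha> (x \<omega>) = hs"
      using tuple_hom[OF \<omega> H hs] .
    let ?\<beta> = "compose (carrier (A\<^sub>\<omega> \<omega>)) \<mu> \<alpha>"
    have "map ?\<beta> (x \<omega>) = map \<mu> hs"
      using \<alpha>(2) generators_carrier[OF set_x_obj[OF \<omega>]] by (auto simp: compose_eq)
    then show ?thesis
      using verbal_op_eq[OF \<omega> H \<alpha>(1), of "w \<omega>"] \<alpha>(2) w[OF \<omega>]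
        verbal_op_eq[OF \<omega> K alg_hom_compose[OF obj_algebra[OF set_x_obj[OF \<omega>]] \<alpha>(1) \<mu>], of "w \<omega>"]
      by (simp add: compose_eq)
  qed
  then show ?thesis
    using \<mu> unfolding alg_hom_def by auto
qed

section \<open>From strongly stable automorphisms to systems of words\<close>

text \<open>At a fixed generator the inverse of \<open>s\<close> drops out, so that evaluating A3)
  there exposes \<open>t\<close> alone.\<close>

lemma conjugate_generator:
  assumes "X \<in> theta0_obj X0" "inj_on s (carrier (F X))" "y \<in> X" "s y = y"
  shows "conjugate (F X) s t \<mu> y = t (\<mu> y)"
  using assms generators_carrier[of X y] inv_into_f_f[of s "carrier (F X)" y]
  unfolding conjugate_def by simp

lemma conjugate_apply:
  assumes "bij_betw s (carrier A) (carrier A)" "a \<in> carrier A"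
  shows "conjugate A s t \<mu> (s a) = t (\<mu> a)"
  using assms bij_betwE[OF assms(1)] unfolding conjugate_def
  by (simp add: bij_betw_def inv_into_f_f)

text \<open>The conjugate is the map component of the image of \<open>(X, \<mu>, Y)\<close> under
  \<open>\<Phi>\<close>, and \<open>\<Phi>\<close> sends arrows to arrows.\<close>

lemma conjugate_stable_hom:
  assumes "is_endofunctor (theta0 \<Sigma> X0 F) \<Phi>" "stable_system \<Sigma> X0 F \<Phi> s"
    and "X \<in> theta0_obj X0" "Y \<in> theta0_obj X0" "\<mu> \<in> alg_hom \<Sigma> (F X) (F Y)"
  shows "conjugate (F X) (s X) (s Y) \<mu> \<in> alg_hom \<Sigma> (F X) (F Y)"
proof -
  have "on_arr \<Phi> (X, \<mu>, Y) \<in> Arr (theta0 \<Sigma> X0 F)"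
    using assms unfolding is_endofunctor_def by (auto dest!: PiE_mem[where x = "(X, \<mu>, Y)"])
  then show ?thesis
    using stable_system_on_arr[OF assms(2-5)] by simp
qed

text \<open>Pick a letter \<open>y\<close> of the sort of \<open>a\<close> and the homomorphism
  \<open>\<alpha>\<close> from the free algebra on \<open>y\<close> with
  \<open>\<alpha> y = a\<close>. The image of \<open>\<alpha>\<close> under \<open>\<Phi>\<close>
  takes the value \<open>s X a\<close> at \<open>y\<close>, whichever system \<open>s\<close> is
  used. This makes the words of \<open>\<Phi>\<close> well defined.\<close>

lemma stable_system_unique:
  assumes s: "stable_system \<Sigma> X0 F \<Phi> s" and s': "stable_system \<Sigma> X0 F \<Phi> s'"
    and X: "X \<in> theta0_obj X0" and a: "a \<in> carrier (F X)"
  shows "s X a = s' X a"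
proof -
  have "srt (F X) a \<in> sorts \<Sigma>"
    using obj_algebra[OF X] a unfolding is_algebra_def is_sorted_set_def by blast
  then obtain y where y: "y \<in> carrier X0" "srt X0 y = srt (F X) a"
    using letters_of_sort unfolding of_sort_def by blast
  then have Y: "{y} \<in> theta0_obj X0"
    unfolding theta0_obj_def by simp
  obtain \<alpha> where \<alpha>: "\<alpha> \<in> alg_hom \<Sigma> (F {y}) (F X)" "\<alpha> y = a"
    using hom_extend[OF Y obj_in_variety[OF X], of "\<lambda>_. a"] a y srt_generator[OF Y]
    unfolding of_sort_def by auto
  have *: "conjugate (F {y}) (t {y}) (t X) \<alpha> y = t X a" if "stable_system \<Sigma> X0 F \<Phi> t" for t
    using conjugate_generator[OF Y] stable_systemD(1,3)[OF that Y] \<alpha>(2)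
    unfolding bij_betw_def by simp
  have "conjugate (F {y}) (s {y}) (s X) \<alpha> = conjugate (F {y}) (s' {y}) (s' X) \<alpha>"
    using stable_system_on_arr[OF s Y X \<alpha>(1)] stable_system_on_arr[OF s' Y X \<alpha>(1)] by simp
  then show ?thesis
    using *[OF s] *[OF s'] by metis
qed

lemma words_of_carrier:
  assumes "stable_system \<Sigma> X0 F \<Phi> s" "\<omega> \<in> ops \<Sigma>"
  shows "words_of \<Sigma> F x s \<omega> \<in> carrier (A\<^sub>\<omega> \<omega>)"
  using assms bij_betwE[OF stable_systemD(1)[OF assms(1) set_x_obj[OF assms(2)]]]
    oper_carrier[OF obj_algebra[OF set_x_obj] _ tuples_x_obj]
  unfolding words_of_def by simp

text \<open>Let \<open>\<alpha>\<close> evaluate words at \<open>as\<close>. Its conjugate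
  \<open>?\<beta>\<close> is a homomorphism sending the generators to the images of
  \<open>as\<close> under \<open>s X\<close>, so the verbal operation there is the value of
  \<open>?\<beta>\<close> at the word of \<open>\<omega>\<close>. As that word is \<open>s\<close>
  of a basic term, the inverse of \<open>s\<close> in \<open>?\<beta>\<close> cancels and
  \<open>s X (oper (F X) \<omega> as)\<close> remains.\<close>

lemma stable_system_iso:
  assumes \<Phi>: "is_endofunctor (theta0 \<Sigma> X0 F) \<Phi>" and s: "stable_system \<Sigma> X0 F \<Phi> s"
    and X: "X \<in> theta0_obj X0"
  shows "restrict (s X) (carrier (F X)) \<in> alg_iso \<Sigma> (F X) (verbal (words_of \<Sigma> F x s) (F X))"
proof -
  \<comment> \<open>A stable system is unconstrained off the carriers, whereas
    \<open>alg_hom\<close> demands extensional maps.\<close>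
  let ?s = "restrict (s X) (carrier (F X))"
  note bij = stable_systemD(1)[OF s X]
  have "s X (oper (F X) \<omega> as) =
      verbal_op \<Sigma> (A\<^sub>\<omega> \<omega>) (x \<omega>) (words_of \<Sigma> F x s \<omega>) (F X) (map ?s as)"
    if \<omega>: "\<omega> \<in> ops \<Sigma>" and as: "as \<in> tuples (F X) (arity \<Sigma> \<omega>)" for \<omega> as
  proof -
    note A = set_x_obj[OF \<omega>]
    obtain \<alpha> where \<alpha>: "\<alpha> \<in> alg_hom \<Sigma> (A\<^sub>\<omega> \<omega>) (F X)" "map \<alpha> (x \<omega>) = as"
      using tuple_hom[OF \<omega> obj_in_variety[OF X] as] .
    let ?\<beta> = "conjugate (A\<^sub>\<omega> \<omega>) (s (set (x \<omega>))) (s X) \<alpha>"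
    have \<beta>: "?\<beta> \<in> alg_hom \<Sigma> (A\<^sub>\<omega> \<omega>) (F X)"
      by (rule conjugate_stable_hom[OF \<Phi> s A X \<alpha>(1)])
    have "?\<beta> y = ?s (\<alpha> y)" if "y \<in> set (x \<omega>)" for y
      using conjugate_generator[OF A _ that] stable_systemD(1,3)[OF s A] that
        alg_hom_carrier[OF \<alpha>(1) generators_carrier[OF A that]]
      unfolding bij_betw_def by simp
    then have "map ?\<beta> (x \<omega>) = map ?s as"
      using \<alpha>(2) by auto
    then have "verbal_op \<Sigma> (A\<^sub>\<omega> \<omega>) (x \<omega>) (words_of \<Sigma> F x s \<omega>) (F X) (map ?s as)
        = ?\<beta> (words_of \<Sigma> F x s \<omega>)"
      using verbal_op_eq[OF \<omega> obj_in_variety[OF X] \<beta>] by metis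
    also have "\<dots> = s X (\<alpha> (oper (A\<^sub>\<omega> \<omega>) \<omega> (x \<omega>)))"
      using conjugate_apply[OF stable_systemD(1)[OF s A]
          oper_carrier[OF obj_algebra[OF A] \<omega> tuples_x_obj[OF \<omega>]]] \<omega>
      unfolding words_of_def by simp
    also have "\<dots> = s X (oper (F X) \<omega> as)"
      using alg_hom_oper[OF \<alpha>(1) \<omega> tuples_x_obj[OF \<omega>]] \<alpha>(2) by simp
    finally show ?thesis by simp
  qed
  then have "?s \<in> alg_hom \<Sigma> (F X) (verbal (words_of \<Sigma> F x s) (F X))"
    using bij_betwE[OF bij] stable_systemD(2)[OF s X] oper_carrier[OF obj_algebra[OF X]]
    unfolding alg_hom_def by auto
  moreover have "bij_betw ?s (carrier (F X)) (carrier (F X))"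
    using bij bij_betw_cong[of "carrier (F X)" ?s "s X"] by simp
  ultimately show ?thesis
    unfolding alg_iso_def by simp
qed

lemma words_of_Op1:
  assumes "stable_system \<Sigma> X0 F \<Phi> s"
  shows "Op1 \<Sigma> F x (words_of \<Sigma> F x s)"
  using words_of_carrier[OF assms] unfolding Op1_def by (auto simp: words_of_def)

lemma words_of_Op2:
  assumes "is_endofunctor (theta0 \<Sigma> X0 F) \<Phi>" "stable_system \<Sigma> X0 F \<Phi> s"
  shows "Op2 \<Sigma> X0 F x (words_of \<Sigma> F x s)"
proof -
  have "\<exists>t\<in>alg_iso \<Sigma> (F X) (verbal (words_of \<Sigma> F x s) (F X)). \<forall>y\<in>X. t y = y"
    if "X \<in> theta0_obj X0" for X
    using stable_system_iso[OF assms that] stable_systemD(3)[OF assms(2) that]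
      generators_carrier[OF that] by (intro bexI) auto
  then show ?thesis
    unfolding Op2_def by blast
qed

section \<open>Injectivity: the words determine the automorphism\<close>

text \<open>The composite \<open>?c\<close> of \<open>t\<close> with the inverse of \<open>s\<close>
  passes through the verbal algebra and back. It is thus an endomorphism of \<open>F X\<close> for
  the original operations that fixes \<open>X\<close>, hence the identity.\<close>

lemma verbal_iso_unique:
  assumes X: "X \<in> theta0_obj X0"
    and s: "s \<in> alg_iso \<Sigma> (F X) (verbal w (F X))" "\<And>y. y \<in> X \<Longrightarrow> s y = y"
    and t: "t \<in> alg_iso \<Sigma> (F X) (verbal w (F X))" "\<And>y. y \<in> X \<Longrightarrow> t y = y"
    and a: "a \<in> carrier (F X)"
  shows "s a = t a"
proof -
  let ?i = "\<lambda>b\<in>carrier (F X). inv_into (carrier (F X)) s b"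
  let ?c = "compose (carrier (F X)) ?i t"
  have bij: "bij_betw s (carrier (F X)) (carrier (F X))"
    and th: "t \<in> alg_hom \<Sigma> (F X) (verbal w (F X))"
    using s(1) t(1) unfolding alg_iso_def by auto
  have i: "?i \<in> alg_hom \<Sigma> (verbal w (F X)) (F X)"
    using alg_iso_inverse[OF obj_algebra[OF X] s(1)] by simp
  have "?c y = y" if "y \<in> X" for y
    using generators_carrier[OF X that] s(2)[OF that] t(2)[OF that] bij
      inv_into_f_f[of s "carrier (F X)" y]
    by (simp add: compose_eq bij_betw_def)
  then have "?c = (\<lambda>b\<in>carrier (F X). b)"
    using generators_carrier[OF X]
    by (intro hom_eqI[OF X obj_in_variety[OF X]] alg_hom_compose[OF obj_algebra[OF X] th i]
        alg_hom_ident obj_algebra[OF X]) simp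
  then have "?c a = a"
    using a by simp
  moreover have "t a \<in> carrier (F X)"
    using alg_hom_carrier[OF th a] by simp
  ultimately have "inv_into (carrier (F X)) s (t a) = a"
    using a by (simp add: compose_eq)
  then show ?thesis
    using bij_betw_inv_into_right[OF bij \<open>t a \<in> carrier (F X)\<close>] by simp
qed

text \<open>Equal words make \<open>s X\<close> and \<open>t X\<close> isomorphisms onto the same
  verbal algebra, so they agree on carriers. Then A3) fixes the action on arrows, A1) that on
  objects, and extensionality settles the rest.\<close>

lemma strongly_stable_eqI:
  assumes \<Phi>: "strongly_stable \<Sigma> X0 F \<Phi>" "stable_system \<Sigma> X0 F \<Phi> s"
    and \<Psi>: "strongly_stable \<Sigma> X0 F \<Psi>" "stable_system \<Sigma> X0 F \<Psi> t"
    and w: "words_of \<Sigma> F x s = words_of \<Sigma> F x t"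
  shows "\<Phi> = \<Psi>"
proof -
  have e: "is_endofunctor (theta0 \<Sigma> X0 F) \<Phi>" "is_endofunctor (theta0 \<Sigma> X0 F) \<Psi>"
    and obj: "\<And>X. X \<in> theta0_obj X0 \<Longrightarrow> on_obj \<Phi> X = on_obj \<Psi> X"
    using \<Phi>(1) \<Psi>(1) unfolding strongly_stable_def is_automorphism_def by auto
  have st: "s X a = t X a" if X: "X \<in> theta0_obj X0" and a: "a \<in> carrier (F X)" for X a
    using verbal_iso_unique[OF X stable_system_iso[OF e(1) \<Phi>(2) X] _
        stable_system_iso[OF e(2) \<Psi>(2) X, folded w] _ a] a
      generators_carrier[OF X] stable_systemD(3)[OF \<Phi>(2) X] stable_systemD(3)[OF \<Psi>(2) X]
    by simp
  have conj: "conjugate (F X) (s X) (s Y) \<mu> = conjugate (F X) (t X) (t Y) \<mu>"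
    if X: "X \<in> theta0_obj X0" and Y: "Y \<in> theta0_obj X0" and \<mu>: "\<mu> \<in> alg_hom \<Sigma> (F X) (F Y)"
    for X Y \<mu>
  proof -
    \<comment> \<open>\<open>inv_into\<close> chooses among elements of the carrier only, so
      agreement there makes both choices equal for every \<open>a\<close>.\<close>
    have "inv_into (carrier (F X)) (s X) a = inv_into (carrier (F X)) (t X) a" for a
      unfolding inv_into_def using st[OF X] by (simp cong: conj_cong)
    moreover have "inv_into (carrier (F X)) (t X) a \<in> carrier (F X)" if "a \<in> carrier (F X)" for a
      using stable_systemD(1)[OF \<Psi>(2) X] that by (simp add: bij_betw_def inv_into_into)
    ultimately show ?thesis
      unfolding conjugate_def using st[OF Y] alg_hom_carrier[OF \<mu>] by (auto intro!: restrict_ext)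
  qed
  have "on_arr \<Phi> f = on_arr \<Psi> f" if "f \<in> Arr (theta0 \<Sigma> X0 F)" for f
    using that stable_system_on_arr[OF \<Phi>(2)] stable_system_on_arr[OF \<Psi>(2)] conj
    by (cases f) auto
  then have "on_arr \<Phi> = on_arr \<Psi>"
    using e unfolding is_endofunctor_def by (intro PiE_ext[of _ "Arr (theta0 \<Sigma> X0 F)"]) auto
  moreover have "on_obj \<Phi> = on_obj \<Psi>"
    using e obj unfolding is_endofunctor_def by (intro PiE_ext[of _ "theta0_obj X0"]) auto
  ultimately show ?thesis
    by simp
qed

section \<open>Surjectivity: every admissible system of words is realized\<close>

text \<open>The conjugations \<open>c\<close> by the chosen isomorphisms and \<open>d\<close> by
  their inverses undo each other. That \<open>d\<close> preserves homomorphisms is direct; for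
  \<open>c\<close> it follows because \<open>d\<close> is onto on each hom-set.\<close>

lemma words_realized:
  assumes Op1: "Op1 \<Sigma> F x w" and Op2: "Op2 \<Sigma> X0 F x w"
  obtains \<Phi> s where "strongly_stable \<Sigma> X0 F \<Phi>" "stable_system \<Sigma> X0 F \<Phi> s" "words_of \<Sigma> F x s = w"
proof -
  have w: "w \<omega> \<in> carrier (A\<^sub>\<omega> \<omega>)" if "\<omega> \<in> ops \<Sigma>" for \<omega>
    using Op1 that unfolding Op1_def by (auto dest: PiE_mem)
  obtain s where s: "\<And>X. X \<in> theta0_obj X0 \<Longrightarrow> s X \<in> alg_iso \<Sigma> (F X) (verbal w (F X))"
    and s_generator: "\<And>X y. X \<in> theta0_obj X0 \<Longrightarrow> y \<in> X \<Longrightarrow> s X y = y"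
    using Op2 unfolding Op2_def by metis
  have bij: "bij_betw (s X) (carrier (F X)) (carrier (F X))"
    and hom: "s X \<in> alg_hom \<Sigma> (F X) (verbal w (F X))" if "X \<in> theta0_obj X0" for X
    using s[OF that] unfolding alg_iso_def by auto
  define inv where "inv X = inv_into (carrier (F X)) (s X)" for X
  have car: "s X a \<in> carrier (F X)" "inv X a \<in> carrier (F X)"
    and s_inv: "s X (inv X a) = a" and inv_s: "inv X (s X a) = a"
    if "X \<in> theta0_obj X0" "a \<in> carrier (F X)" for X a
    using that bij[OF that(1)] unfolding inv_def
    by (auto simp: bij_betw_def inv_into_into f_inv_into_f inv_into_f_f)
  have srt: "srt (F X) (s X a) = srt (F X) a" if "X \<in> theta0_obj X0" "a \<in> carrier (F X)" for X a
    using alg_hom_srt[OF hom that(2)] that(1) by simp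
  define c where "c X Y \<mu> = conjugate (F X) (s X) (s Y) \<mu>" for X Y \<mu>
  have c: "c X Y \<mu> a = s Y (\<mu> (inv X a))" if "a \<in> carrier (F X)" for X Y \<mu> a
    using that unfolding c_def conjugate_def inv_def by simp

  \<comment> \<open>This is a composite of homomorphisms \<open>F X \<rightarrow> verbal w (F X)
    \<rightarrow> verbal w (F Y) \<rightarrow> F Y\<close>.\<close>
  define d where "d X Y \<nu> = (\<lambda>a\<in>carrier (F X). inv Y (\<nu> (s X a)))" for X Y \<nu>
  have d_hom: "d X Y \<nu> \<in> alg_hom \<Sigma> (F X) (F Y)"
    if X: "X \<in> theta0_obj X0" and Y: "Y \<in> theta0_obj X0" and \<nu>: "\<nu> \<in> alg_hom \<Sigma> (F X) (F Y)"
    for X Y \<nu>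
  proof -
    have "(\<lambda>b\<in>carrier (F Y). inv Y b) \<in> alg_hom \<Sigma> (verbal w (F Y)) (F Y)"
      using alg_iso_inverse[OF obj_algebra[OF Y] s[OF Y]] unfolding inv_def by simp
    moreover have "\<nu> \<in> alg_hom \<Sigma> (verbal w (F X)) (verbal w (F Y))"
      using hom_verbal[OF obj_in_variety[OF X] obj_in_variety[OF Y] \<nu> w] .
    ultimately have "compose (carrier (F X)) (\<lambda>b\<in>carrier (F Y). inv Y b)
        (compose (carrier (F X)) \<nu> (s X)) \<in> alg_hom \<Sigma> (F X) (F Y)"
      using alg_hom_compose[OF obj_algebra[OF X]] hom[OF X] by blast
    also have "compose (carrier (F X)) (\<lambda>b\<in>carrier (F Y). inv Y b)
        (compose (carrier (F X)) \<nu> (s X)) = d X Y \<nu>"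
      unfolding d_def compose_def using car(1)[OF X] alg_hom_carrier[OF \<nu>]
      by (auto intro!: restrict_ext)
    finally show ?thesis .
  qed
  have cd: "c X Y (d X Y \<nu>) = \<nu>"
    if X: "X \<in> theta0_obj X0" and Y: "Y \<in> theta0_obj X0" and \<nu>: "\<nu> \<in> alg_hom \<Sigma> (F X) (F Y)"
    for X Y \<nu>
  proof (rule extensionalityI[where A = "carrier (F X)"])
    show "\<nu> \<in> extensional (carrier (F X))"
      using alg_hom_extensional[OF \<nu>] by (simp add: PiE_def)
    show "c X Y (d X Y \<nu>) a = \<nu> a" if "a \<in> carrier (F X)" for a
      using that car[OF X] s_inv[OF X] s_inv[OF Y] alg_hom_carrier[OF \<nu>] by (simp add: c d_def)
  qed (simp add: c_def conjugate_def)
  have dc: "d X Y (c X Y \<mu>) = \<mu>"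
    if X: "X \<in> theta0_obj X0" and Y: "Y \<in> theta0_obj X0" and \<mu>: "\<mu> \<in> alg_hom \<Sigma> (F X) (F Y)"
    for X Y \<mu>
  proof (rule extensionalityI[where A = "carrier (F X)"])
    show "\<mu> \<in> extensional (carrier (F X))"
      using alg_hom_extensional[OF \<mu>] by (simp add: PiE_def)
    show "d X Y (c X Y \<mu>) a = \<mu> a" if "a \<in> carrier (F X)" for a
      using that car[OF X] inv_s[OF X] inv_s[OF Y] alg_hom_carrier[OF \<mu>] by (simp add: c d_def)
  qed (simp add: d_def)
  have c_hom: "c X Y \<mu> \<in> alg_hom \<Sigma> (F X) (F Y)"
    if X: "X \<in> theta0_obj X0" and Y: "Y \<in> theta0_obj X0" and \<mu>: "\<mu> \<in> alg_hom \<Sigma> (F X) (F Y)"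
    for X Y \<mu>
  proof -
    have "s Y (\<mu> y) \<in> of_sort (F Y) (srt (F X) y)" if "y \<in> X" for y
      using generators_carrier[OF X that] car(1)[OF Y] srt[OF Y] alg_hom_carrier[OF \<mu>]
        alg_hom_srt[OF \<mu>] unfolding of_sort_def by auto
    \<comment> \<open>\<open>\<nu>\<close> gets the values that \<open>c X Y \<mu>\<close> has on
      generators. Then \<open>d X Y \<nu>\<close> and \<open>\<mu>\<close> are homomorphisms
      agreeing on \<open>X\<close>, so they coincide, and applying \<open>c\<close> returns
      \<open>\<nu>\<close>.\<close>
    from hom_extend[OF X obj_in_variety[OF Y] this] obtain \<nu>
      where \<nu>: "\<nu> \<in> alg_hom \<Sigma> (F X) (F Y)" and \<nu>y: "\<And>y. y \<in> X \<Longrightarrow> \<nu> y = s Y (\<mu> y)" by blast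
    have "d X Y \<nu> y = \<mu> y" if "y \<in> X" for y
      using generators_carrier[OF X that] s_generator[OF X that] \<nu>y[OF that] inv_s[OF Y]
        alg_hom_carrier[OF \<mu>] unfolding d_def by simp
    then have "d X Y \<nu> = \<mu>"
      by (rule hom_eqI[OF X obj_in_variety[OF Y] d_hom[OF X Y \<nu>] \<mu>])
    then show ?thesis
      using cd[OF X Y \<nu>] \<nu> by simp
  qed

  let ?C = "theta0 \<Sigma> X0 F"
  \<comment> \<open>Both components are restricted, since \<open>is_endofunctor\<close> asks for
    extensional maps.\<close>
  define \<Phi> :: "('a set, 'a set \<times> ('a \<Rightarrow> 'a) \<times> 'a set) endofunctor" where
    "\<Phi> = \<lparr>on_obj = (\<lambda>X\<in>theta0_obj X0. X), on_arr = (\<lambda>(X, \<mu>, Y)\<in>Arr ?C. (X, c X Y \<mu>, Y))\<rparr>"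
  have obj: "on_obj \<Phi> X = X" if "X \<in> theta0_obj X0" for X
    using that by (simp add: \<Phi>_def)
  have arr: "on_arr \<Phi> (X, \<mu>, Y) = (X, c X Y \<mu>, Y)"
    if "X \<in> theta0_obj X0" "Y \<in> theta0_obj X0" "\<mu> \<in> alg_hom \<Sigma> (F X) (F Y)" for X Y \<mu>
    using that by (simp add: \<Phi>_def)
  have ident: "c X X (\<lambda>a\<in>carrier (F X). a) = (\<lambda>a\<in>carrier (F X). a)" if X: "X \<in> theta0_obj X0" for X
    by (rule extensionalityI[where A = "carrier (F X)"])
      (auto simp: c car[OF X] s_inv[OF X], simp add: c_def conjugate_def)
  \<comment> \<open>In the middle of the right-hand side \<open>inv Y\<close> meets
    \<open>s Y\<close> and cancels.\<close>
  have comp: "c X Z (compose (carrier (F X)) \<nu> \<mu>) = compose (carrier (F X)) (c Y Z \<nu>) (c X Y \<mu>)"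
    if X: "X \<in> theta0_obj X0" and Y: "Y \<in> theta0_obj X0" and \<mu>: "\<mu> \<in> alg_hom \<Sigma> (F X) (F Y)"
    for X Y Z \<mu> \<nu>
    by (rule extensionalityI[where A = "carrier (F X)"])
      (auto simp: c compose_eq car[OF X] car[OF Y] inv_s[OF Y] alg_hom_carrier[OF \<mu>],
        simp add: c_def conjugate_def)
  have arrows: "on_arr \<Phi> \<in> Arr ?C \<rightarrow>\<^sub>E Arr ?C"
  proof (rule PiE_I)
    show "on_arr \<Phi> f \<in> Arr ?C" if "f \<in> Arr ?C" for f
      using that by (cases f) (auto simp: arr c_hom)
    show "on_arr \<Phi> f = undefined" if "f \<notin> Arr ?C" for f
      using that by (simp add: \<Phi>_def)
  qed
  have objects: "on_obj \<Phi> \<in> Obj ?C \<rightarrow>\<^sub>E Obj ?C"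
    by (auto simp: \<Phi>_def)
  have dom_cod: "Dom ?C (on_arr \<Phi> f) = on_obj \<Phi> (Dom ?C f) \<and>
      Cod ?C (on_arr \<Phi> f) = on_obj \<Phi> (Cod ?C f)" if "f \<in> Arr ?C" for f
    using that by (cases f) (auto simp: arr obj)
  have on_ident: "on_arr \<Phi> (Ident ?C X) = Ident ?C (on_obj \<Phi> X)" if "X \<in> Obj ?C" for X
    using that by (simp add: arr obj ident alg_hom_ident obj_algebra)
  have on_comp: "on_arr \<Phi> (Comp ?C g f) = Comp ?C (on_arr \<Phi> g) (on_arr \<Phi> f)"
    if f: "f \<in> Arr ?C" and g: "g \<in> Arr ?C" and fg: "Cod ?C f = Dom ?C g" for f g
  proof -
    obtain X \<mu> Y where f': "f = (X, \<mu>, Y)" by (cases f)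
    obtain \<nu> Z where g': "g = (Y, \<nu>, Z)" using fg f' by (cases g) auto
    have X: "X \<in> theta0_obj X0" and Y: "Y \<in> theta0_obj X0" and Z: "Z \<in> theta0_obj X0"
      and \<mu>: "\<mu> \<in> alg_hom \<Sigma> (F X) (F Y)" and \<nu>: "\<nu> \<in> alg_hom \<Sigma> (F Y) (F Z)"
      using f g unfolding f' g' by simp_all
    show ?thesis
      unfolding f' g' theta0_simps arr[OF X Y \<mu>] arr[OF Y Z \<nu>]
        arr[OF X Z alg_hom_compose[OF obj_algebra[OF X] \<mu> \<nu>]] comp[OF X Y \<mu>] ..
  qed
  have "is_endofunctor ?C \<Phi>"
    unfolding is_endofunctor_def using arrows objects dom_cod on_ident on_comp by blast
  moreover have "bij_betw (on_obj \<Phi>) (Obj ?C) (Obj ?C)"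
    using obj bij_betw_cong[of "theta0_obj X0" "on_obj \<Phi>" id] by simp
  moreover have "bij_betw (on_arr \<Phi>) (Arr ?C) (Arr ?C)"
    using arrows
    by (intro bij_betw_byWitness[where f' = "\<lambda>(X, \<nu>, Y). (X, d X Y \<nu>, Y)"])
      (auto simp: arr c_hom d_hom cd dc)
  moreover have st: "stable_system \<Sigma> X0 F \<Phi> s"
    unfolding stable_system_def using bij srt s_generator arr by (auto simp: c_def conjugate_def)
  ultimately have "strongly_stable \<Sigma> X0 F \<Phi>"
    unfolding strongly_stable_def is_automorphism_def using obj by blast
  moreover have "words_of \<Sigma> F x s = w"
  proof (rule extensionalityI[where A = "ops \<Sigma>"])
    show "w \<in> extensional (ops \<Sigma>)"
      using Op1 unfolding Op1_def by (simp add: PiE_def)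
    show "words_of \<Sigma> F x s \<omega> = w \<omega>" if \<omega>: "\<omega> \<in> ops \<Sigma>" for \<omega>
    proof -
      note A = set_x_obj[OF \<omega>]
      let ?id = "\<lambda>a\<in>carrier (A\<^sub>\<omega> \<omega>). a"
      have "words_of \<Sigma> F x s \<omega> = s (set (x \<omega>)) (oper (A\<^sub>\<omega> \<omega>) \<omega> (x \<omega>))"
        using \<omega> unfolding words_of_def by simp
      also have "\<dots> = verbal_op \<Sigma> (A\<^sub>\<omega> \<omega>) (x \<omega>) (w \<omega>) (A\<^sub>\<omega> \<omega>) (map (s (set (x \<omega>))) (x \<omega>))"
        using alg_hom_oper[OF hom[OF A] \<omega> tuples_x_obj[OF \<omega>]] by simp
      \<comment> \<open>As \<open>s\<close> fixes the generators, the word is evaluated by the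
        identity of \<open>A\<^sub>\<omega> \<omega>\<close>, which returns the word itself.\<close>
      also have "map (s (set (x \<omega>))) (x \<omega>) = map ?id (x \<omega>)"
        using s_generator[OF A] generators_carrier[OF A] by (intro map_cong) simp_all
      also have "verbal_op \<Sigma> (A\<^sub>\<omega> \<omega>) (x \<omega>) (w \<omega>) (A\<^sub>\<omega> \<omega>) (map ?id (x \<omega>)) = ?id (w \<omega>)"
        by (rule verbal_op_eq[OF \<omega> obj_in_variety[OF A] alg_hom_ident[OF obj_algebra[OF A]]])
      finally show ?thesis
        using w[OF \<omega>] by simp
    qed
  qed (simp add: words_of_def)
  ultimately show ?thesis
    using that st by blast
qed

section \<open>The one-to-one correspondence\<close>

text \<open>\<open>W\<close> is built from an arbitrarily chosen stable system of each automorphism.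
  Uniqueness of that system on carriers gives the formula for every other choice; injectivity and
  surjectivity are the two preceding parts.\<close>

lemma words_of_bijection:
  "\<exists>W. bij_betw W {\<Phi>. strongly_stable \<Sigma> X0 F \<Phi>} {w. Op1 \<Sigma> F x w \<and> Op2 \<Sigma> X0 F x w} \<and>
     (\<forall>\<Phi> s. strongly_stable \<Sigma> X0 F \<Phi> \<longrightarrow> stable_system \<Sigma> X0 F \<Phi> s \<longrightarrow> W \<Phi> = words_of \<Sigma> F x s)"
proof -
  define S where "S \<Phi> = (SOME s. stable_system \<Sigma> X0 F \<Phi> s)" for \<Phi>
  define W where "W \<Phi> = words_of \<Sigma> F x (S \<Phi>)" for \<Phi>
  have S: "stable_system \<Sigma> X0 F \<Phi> (S \<Phi>)" if "strongly_stable \<Sigma> X0 F \<Phi>" for \<Phi>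
    using that someI_ex[of "stable_system \<Sigma> X0 F \<Phi>"] unfolding strongly_stable_def S_def by simp
  have W: "W \<Phi> = words_of \<Sigma> F x s"
    if "strongly_stable \<Sigma> X0 F \<Phi>" "stable_system \<Sigma> X0 F \<Phi> s" for \<Phi> s
    unfolding W_def words_of_def
  proof (rule restrict_ext)
    fix \<omega> assume \<omega>: "\<omega> \<in> ops \<Sigma>"
    note A = set_x_obj[OF \<omega>]
    show "S \<Phi> (set (x \<omega>)) (oper (A\<^sub>\<omega> \<omega>) \<omega> (x \<omega>)) = s (set (x \<omega>)) (oper (A\<^sub>\<omega> \<omega>) \<omega> (x \<omega>))"
      by (rule stable_system_unique[OF S[OF that(1)] that(2) A
            oper_carrier[OF obj_algebra[OF A] \<omega> tuples_x_obj[OF \<omega>]]])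
  qed
  have "inj_on W {\<Phi>. strongly_stable \<Sigma> X0 F \<Phi>}"
  proof (rule inj_onI, unfold mem_Collect_eq)
    fix \<Phi> \<Psi>
    assume \<Phi>: "strongly_stable \<Sigma> X0 F \<Phi>" and \<Psi>: "strongly_stable \<Sigma> X0 F \<Psi>" and "W \<Phi> = W \<Psi>"
    then show "\<Phi> = \<Psi>"
      using strongly_stable_eqI[OF \<Phi> S[OF \<Phi>] \<Psi> S[OF \<Psi>]] unfolding W_def by blast
  qed
  moreover have "W ` {\<Phi>. strongly_stable \<Sigma> X0 F \<Phi>} = {w. Op1 \<Sigma> F x w \<and> Op2 \<Sigma> X0 F x w}"
  proof (intro equalityI subsetI)
    fix w assume "w \<in> W ` {\<Phi>. strongly_stable \<Sigma> X0 F \<Phi>}"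
    then obtain \<Phi> where \<Phi>: "strongly_stable \<Sigma> X0 F \<Phi>" and w: "w = W \<Phi>"
      by blast
    then have "is_endofunctor (theta0 \<Sigma> X0 F) \<Phi>"
      unfolding strongly_stable_def is_automorphism_def by simp
    then show "w \<in> {w. Op1 \<Sigma> F x w \<and> Op2 \<Sigma> X0 F x w}"
      using words_of_Op1[OF S[OF \<Phi>]] words_of_Op2[OF _ S[OF \<Phi>]] w unfolding W_def by simp
  next
    fix w assume "w \<in> {w. Op1 \<Sigma> F x w \<and> Op2 \<Sigma> X0 F x w}"
    then obtain \<Phi> s where \<Phi>: "strongly_stable \<Sigma> X0 F \<Phi>" "stable_system \<Sigma> X0 F \<Phi> s"
      and "words_of \<Sigma> F x s = w"
      using words_realized by blast
    then have "w = W \<Phi>"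
      using W[OF \<Phi>] by simp
    then show "w \<in> W ` {\<Phi>. strongly_stable \<Sigma> X0 F \<Phi>}"
      using \<Phi>(1) by blast
  qed
  ultimately have "bij_betw W {\<Phi>. strongly_stable \<Sigma> X0 F \<Phi>} {w. Op1 \<Sigma> F x w \<and> Op2 \<Sigma> X0 F x w}"
    unfolding bij_betw_def ..
  then show ?thesis
    by (intro exI[of _ W] conjI allI impI W)
qed

end

theorem theorem3p1:
  fixes \<Sigma> :: "('o, 's) signature"
    and V :: "('v, 's) sorted_set"
    and E :: "(('v, 'o) trm \<times> ('v, 'o) trm) set"
    and \<Theta> :: "('a, 's, 'o) algebra set"
    and X0 :: "('a, 's) sorted_set"
    and F :: "'a set \<Rightarrow> ('a, 's, 'o) algebra"
    and x :: "'o \<Rightarrow> 'a list"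
  assumes "wf_signature \<Sigma>"
    and "is_sorted_set \<Sigma> V" and "E \<subseteq> identities \<Sigma> V" and "\<Theta> = variety \<Sigma> V E"
    and "is_sorted_set \<Sigma> X0"
    and "\<And>i. i \<in> sorts \<Sigma> \<Longrightarrow> countable (of_sort X0 i) \<and> infinite (of_sort X0 i)"
    and "\<And>X. X \<in> theta0_obj X0 \<Longrightarrow> is_free \<Sigma> \<Theta> (F X) X \<and> (\<forall>y\<in>X. srt (F X) y = srt X0 y)"
    and "\<And>\<omega>. \<omega> \<in> ops \<Sigma> \<Longrightarrow> distinct (x \<omega>) \<and> x \<omega> \<in> tuples X0 (arity \<Sigma> \<omega>)"
    and "\<And>\<Phi> i y. is_automorphism (theta0 \<Sigma> X0 F) \<Phi> \<Longrightarrow> i \<in> sorts \<Sigma> \<Longrightarrow> y \<in> of_sort X0 i \<Longrightarrow>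
           alg_iso \<Sigma> (F (on_obj \<Phi> {y})) (F {y}) \<noteq> {}"
  shows "\<exists>W. bij_betw W {\<Phi>. strongly_stable \<Sigma> X0 F \<Phi>} {w. Op1 \<Sigma> F x w \<and> Op2 \<Sigma> X0 F x w} \<and>
           (\<forall>\<Phi> s. strongly_stable \<Sigma> X0 F \<Phi> \<longrightarrow> stable_system \<Sigma> X0 F \<Phi> s \<longrightarrow>
              W \<Phi> = words_of \<Sigma> F x s)"
proof -
  interpret free_objects \<Sigma> \<Theta> X0 F x
  proof
    show "is_algebra \<Sigma> A" if "A \<in> \<Theta>" for A
      using that \<open>\<Theta> = variety \<Sigma> V E\<close> unfolding variety_def by simp
    show "of_sort X0 i \<noteq> {}" if "i \<in> sorts \<Sigma>" for i
      using assms(6)[OF that] by auto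
  qed (use assms(7,8) in auto)
  show ?thesis
    by (rule words_of_bijection)
qed

end
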